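(* Let $\Gamma$ be a $PT$-graph of type 2(c). Then there exists an ordering of the vertices of $\Gamma$ whose corresponding $(0,1,-1)$-matrix is an alternating sign matrix if and only if it is not the case that one of the two cycles of $\Gamma_P$ has length $2$ and the two vertices of $\Gamma_T$ lying in the other cycle are consecutive in that cycle.
   Context: A $PT$-graph of type 2(c) is a 2-arc-coloured digraph whose arcs are: blue arcs $\Gamma_P$ forming two vertex-disjoint directed cycles covering all vertices; and four further arcs forming $\Gamma_T$, namely red arcs $(u_1,v_1)$, $(u_2,v_2)$ and blue arcs $(u_1,v_2)$, $(u_2,v_1)$, where $u_1,u_2$ are distinct vertices of one cycle and $v_1,v_2$ are distinct vertices of the other cycle. Given an ordering $w_1,\dots,w_n$ of the vertices, the corresponding $(0,1,-1)$-matrix $A$ has $A_{ij}=1$ if $(w_i,w_j)$ is a blue arc, $-1$ if it is a red arc, $0$ otherwise. An alternating sign matrix is a square $(0,1,-1)$-matrix in which the non-zero entries of each row and column alternate in sign, beginning and ending with $+1$. Two vertices of a directed cycle are consecutive if they are joined by an arc of the cycle. *)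

theory Defs
  imports "Graph_Theory.Pair_Digraph" "Jordan_Normal_Form.Matrix"
begin

datatype colour = Blue | Red

(* C consists of exactly the arcs and vertices of a directed cycle in the sense of
   pre_digraph.cycle, so card (parcs C) is its length. *)
definition directed_cycle :: "'a pair_pre_digraph \<Rightarrow> bool" where
  "directed_cycle C \<longleftrightarrow>
     (\<exists>p. pre_digraph.cycle (with_proj C) p \<and> set p = parcs C \<and> fst ` set p = pverts C)"

definition consecutive :: "'a pair_pre_digraph \<Rightarrow> 'a \<Rightarrow> 'a \<Rightarrow> bool" where
  "consecutive C x y \<longleftrightarrow> (x, y) \<in> parcs C \<or> (y, x) \<in> parcs C"

(* C1 and C2 form the subgraph of P-arcs; the four arcs between them are the T-arcs.
   Only the values of \<kappa> on arcs of G matter. *)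
locale PT_graph_2c = pair_digraph G
  for G :: "'a pair_pre_digraph" +
  fixes \<kappa> :: "'a \<times> 'a \<Rightarrow> colour"
    and C1 C2 :: "'a pair_pre_digraph"
    and u1 u2 v1 v2 :: 'a
  assumes cycle1: "directed_cycle C1"
    and cycle2: "directed_cycle C2"
    and disjoint: "pverts C1 \<inter> pverts C2 = {}"
    and verts_eq: "pverts G = pverts C1 \<union> pverts C2"
    and u_in: "u1 \<in> pverts C1" "u2 \<in> pverts C1" "u1 \<noteq> u2"
    and v_in: "v1 \<in> pverts C2" "v2 \<in> pverts C2" "v1 \<noteq> v2"
    and arcs_eq: "parcs G = parcs C1 \<union> parcs C2 \<union> {(u1, v1), (u2, v2), (u1, v2), (u2, v1)}"
    and P_blue: "\<And>e. e \<in> parcs C1 \<union> parcs C2 \<Longrightarrow> \<kappa> e = Blue"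
    and T_red: "\<kappa> (u1, v1) = Red" "\<kappa> (u2, v2) = Red"
    and T_blue: "\<kappa> (u1, v2) = Blue" "\<kappa> (u2, v1) = Blue"

definition vertex_ordering :: "'a pair_pre_digraph \<Rightarrow> 'a list \<Rightarrow> bool" where
  "vertex_ordering G ws \<longleftrightarrow> distinct ws \<and> set ws = pverts G"

definition colour_mat ::
  "'a pair_pre_digraph \<Rightarrow> ('a \<times> 'a \<Rightarrow> colour) \<Rightarrow> 'a list \<Rightarrow> int mat" where
  "colour_mat G \<kappa> ws = mat (length ws) (length ws) (\<lambda>(i, j).
     if (ws ! i, ws ! j) \<in> parcs G
     then (case \<kappa> (ws ! i, ws ! j) of Blue \<Rightarrow> 1 | Red \<Rightarrow> -1)
     else 0)"

(* For entries in {0, 1, -1}, alternation in sign means that each non-zero entry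
   is the negative of the preceding one. *)
definition alternating_vec :: "int vec \<Rightarrow> bool" where
  "alternating_vec v \<longleftrightarrow>
     (let xs = filter (\<lambda>x. x \<noteq> 0) (list_of_vec v)
      in xs \<noteq> [] \<and> hd xs = 1 \<and> last xs = 1 \<and> successively (\<lambda>x y. y = - x) xs)"

definition alternating_sign_matrix :: "int mat \<Rightarrow> bool" where
  "alternating_sign_matrix A \<longleftrightarrow>
     square_mat A \<and> elements_mat A \<subseteq> {0, 1, -1} \<and>
     (\<forall>i < dim_row A. alternating_vec (row A i)) \<and>
     (\<forall>j < dim_col A. alternating_vec (col A j))"

end

theory Submission
  imports Defs
begin

text \<open>
  Let \<open>s\<close> and \<open>t\<close> be the successor and predecessor maps of the two cycles. All rows and columns
  have a single non-zero entry, a \<open>1\<close>, except the rows of \<open>u1\<close>, \<open>u2\<close> and the columns of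
  \<open>v1\<close>, \<open>v2\<close>, which have three. So an ordering is good iff \<open>v1\<close> lies between \<open>s u1\<close> and \<open>v2\<close>,
  \<open>v2\<close> between \<open>s u2\<close> and \<open>v1\<close>, \<open>u1\<close> between \<open>t v1\<close> and \<open>u2\<close>, and \<open>u2\<close> between \<open>t v2\<close> and \<open>u1\<close>.
  Such an ordering fails to exist exactly when at least three of the four coincidences
  \<open>s u1 = u2\<close>, \<open>s u2 = u1\<close>, \<open>t v1 = v2\<close>, \<open>t v2 = v1\<close> hold, that is, when one cycle has length 2
  and the two vertices in the other one are consecutive.
\<close>

section \<open>Directed cycles\<close>

text \<open>Each arc of a walk starts where the previous one ends, so tails and heads agree up to a
  shift. For a closed walk this makes the heads a rotation of the tails.\<close>

lemma cas_with_proj_verts: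
  "pre_digraph.cas (with_proj C) u p v \<Longrightarrow> u # map snd p = map fst p @ [v]"
proof (induction p arbitrary: u)
  case Nil
  then show ?case by (simp add: pre_digraph.cas.simps)
next
  case (Cons e p)
  then have "fst e = u" "pre_digraph.cas (with_proj C) (snd e) p v"
    by (simp_all add: pre_digraph.cas.simps)
  with Cons.IH show ?case by auto
qed

text \<open>The tails of the arcs of the closed walk, read in order, list the vertices in cyclic
  order.\<close>

lemma directed_cycle_list:
  assumes "directed_cycle C"
  obtains vs where "vs \<noteq> []" "distinct vs" "set vs = pverts C"
    "parcs C = set (zip vs (rotate1 vs))"
proof -
  obtain p where p: "pre_digraph.cycle (with_proj C) p" "set p = parcs C" "fst ` set p = pverts C"
    using assms unfolding directed_cycle_def by blast
  from p(1) obtain u where u: "pre_digraph.cas (with_proj C) u p u"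
      "distinct (tl (pre_digraph.awalk_verts (with_proj C) u p))" "p \<noteq> []"
    unfolding pre_digraph.cycle_def pre_digraph.awalk_def by blast
  have cas: "u # map snd p = map fst p @ [u]"
    using cas_with_proj_verts[OF u(1)] .
  have rot: "map snd p = rotate1 (map fst p)"
    using cas u(3) by (cases p) auto
  \<comment> \<open>Dropping the start vertex leaves the heads, so the distinctness required of a
    cycle is distinctness of \<open>map snd p\<close>.\<close>
  have "pre_digraph.awalk_verts (with_proj C) w q = w # map snd q"
    if "pre_digraph.cas (with_proj C) w q z" for w q z
    using that by (induction q arbitrary: w) (auto simp: pre_digraph.cas.simps pre_digraph.awalk_verts.simps)
  with u have "distinct (map snd p)" by simp
  then have "distinct (map fst p)" unfolding rot by simp
  show thesis
  proof (rule that[of "map fst p"])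
    show "parcs C = set (zip (map fst p) (rotate1 (map fst p)))"
      unfolding rot[symmetric] zip_map_fst_snd p(2) ..
  qed (use \<open>distinct (map fst p)\<close> p(3) u(3) in simp_all)
qed

text \<open>The last property says that \<open>s\<close> has a single orbit, without mentioning
  iterates.\<close>

lemma directed_cycle_successor:
  assumes "directed_cycle C"
  obtains s where "finite (pverts C)" "bij_betw s (pverts C) (pverts C)"
    "parcs C = (\<lambda>x. (x, s x)) ` pverts C"
    "\<And>S. S \<subseteq> pverts C \<Longrightarrow> S \<noteq> {} \<Longrightarrow> s ` S \<subseteq> S \<Longrightarrow> S = pverts C"
proof -
  obtain vs where vs: "vs \<noteq> []" "distinct vs" "set vs = pverts C"
    "parcs C = set (zip vs (rotate1 vs))"
    using directed_cycle_list[OF assms] .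
  define n where "n = length vs"
  have n: "n > 0" using vs(1) by (simp add: n_def)
  define s where "s = (\<lambda>x. the (map_of (zip vs (rotate1 vs)) x))"
  have s_nth: "s (vs ! i) = vs ! (Suc i mod n)" if "i < n" for i
    using that vs(2) map_of_zip_nth[of vs "rotate1 vs" i]
    by (simp add: s_def n_def nth_rotate1)
  have "map s vs = rotate1 vs"
    by (rule nth_equalityI) (auto simp: s_nth nth_rotate1 n_def)
  then have "distinct (map s vs)" "set (map s vs) = set vs"
    using vs(2) by simp_all
  then have bij: "bij_betw s (pverts C) (pverts C)"
    using vs(3) by (simp add: bij_betw_def distinct_map)
  have "zip vs (rotate1 vs) = map (\<lambda>x. (x, s x)) vs"
    unfolding \<open>map s vs = rotate1 vs\<close>[symmetric] by (simp add: zip_map2 zip_same_conv_map)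
  then have arcs: "parcs C = (\<lambda>x. (x, s x)) ` pverts C"
    using vs(3,4) by auto
  have closed: "S = pverts C" if S: "S \<subseteq> pverts C" "S \<noteq> {}" "s ` S \<subseteq> S" for S
  proof -
    obtain x where "x \<in> S" using S(2) by blast
    then obtain i where i: "i < n" "vs ! i \<in> S"
      using S(1) vs(3) by (metis in_set_conv_nth n_def subsetD)
    have step: "vs ! ((i + k) mod n) \<in> S" for k
    proof (induction k)
      case 0
      then show ?case using i by simp
    next
      case (Suc k)
      have "s (vs ! ((i + k) mod n)) = vs ! ((i + Suc k) mod n)"
        using s_nth[of "(i + k) mod n"] n by (simp add: mod_Suc_eq)
      with Suc S(3) show ?case by (metis image_subset_iff)
    qed
    \<comment> \<open>Walking \<open>n - i\<close> steps from index \<open>i\<close> wraps round to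
      index 0, and \<open>j\<close> more steps reach \<open>j\<close>.\<close>
    have "vs ! j \<in> S" if "j < n" for j
      using step[of "n - i + j"] that i by simp
    then show ?thesis
      using S(1) vs(3) by (metis in_set_conv_nth n_def subsetI subset_antisym)
  qed
  show thesis
    by (rule that[OF _ bij arcs closed]) (simp_all flip: vs(3))
qed

text \<open>A fixed point would be a closed singleton, hence all of \<open>V\<close>, which has two
  distinct elements.\<close>

lemma no_fixed_point:
  assumes "a \<in> V" "b \<in> V" "a \<noteq> b" "x \<in> V"
    and min: "\<And>S. S \<subseteq> V \<Longrightarrow> S \<noteq> {} \<Longrightarrow> s ` S \<subseteq> S \<Longrightarrow> S = V"
  shows "s x \<noteq> x"
proof
  assume "s x = x"
  then have "V = {x}" using min[of "{x}"] assms(4) by simp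
  with assms(1-3) show False by simp
qed

text \<open>Arcs correspond to their tails, so the count is \<open>card V\<close>. On two points a
  map without fixed points is the swap; conversely a swapped pair is closed under \<open>s\<close>
  and so exhausts \<open>V\<close>.\<close>

lemma card_parcs_eq_2_iff:
  assumes "finite V" "bij_betw s V V" "x \<in> V" "y \<in> V" "x \<noteq> y"
    and min: "\<And>S. S \<subseteq> V \<Longrightarrow> S \<noteq> {} \<Longrightarrow> s ` S \<subseteq> S \<Longrightarrow> S = V"
  shows "card ((\<lambda>x. (x, s x)) ` V) = 2 \<longleftrightarrow> s x = y \<and> s y = x"
proof -
  have card: "card ((\<lambda>x. (x, s x)) ` V) = card V"
    by (rule card_image) (simp add: inj_on_def)
  have no_fix: "s z \<noteq> z" if "z \<in> V" for z
    using no_fixed_point[OF assms(3-5) that min] .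
  show ?thesis
  proof
    assume "card ((\<lambda>x. (x, s x)) ` V) = 2"
    with card have "V = {x, y}"
      using assms(3-5) by (auto simp: card_2_iff)
    moreover have "s x \<in> V" "s y \<in> V"
      using assms(2-4) by (auto simp: bij_betw_def)
    ultimately show "s x = y \<and> s y = x"
      using no_fix by auto
  next
    assume "s x = y \<and> s y = x"
    then have "V = {x, y}" using min[of "{x, y}"] assms(3,4) by auto
    then show "card ((\<lambda>x. (x, s x)) ` V) = 2" using card assms(5) by simp
  qed
qed

section \<open>Alternating lists\<close>

text \<open>The condition of \<open>alternating_vec\<close> moved to lists, so that rows and columns
  become \<open>map f ws\<close> with \<open>f\<close> a function of vertices.\<close>

definition alternating_list :: "int list \<Rightarrow> bool" where
  "alternating_list ys \<longleftrightarrow>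
     (let xs = filter (\<lambda>x. x \<noteq> 0) ys
      in xs \<noteq> [] \<and> hd xs = 1 \<and> last xs = 1 \<and> successively (\<lambda>x y. y = - x) xs)"

lemma alternating_list_single:
  assumes "distinct ws" "{x \<in> set ws. f x \<noteq> 0} = {a}" "f a = 1"
  shows "alternating_list (map f ws)"
proof -
  define l where "l = filter (\<lambda>x. f x \<noteq> 0) ws"
  have l: "distinct l" "set l = {a}"
    using assms(1,2) by (simp_all add: l_def)
  have "length l = 1" using distinct_card[OF l(1)] l(2) by simp
  then obtain y where "l = [y]" by (metis One_nat_def length_0_conv length_Suc_conv)
  with l(2) have "l = [a]" by simp
  then show ?thesis
    using assms(3) by (simp add: alternating_list_def filter_map comp_def l_def)
qed

text \<open>Phrased with an arbitrary rank instead of list positions, so that a witness may give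
  several vertices the same rank.\<close>

definition between :: "('a \<Rightarrow> nat) \<Rightarrow> 'a \<Rightarrow> 'a \<Rightarrow> 'a \<Rightarrow> bool" where
  "between r a b c \<longleftrightarrow> r a < r b \<and> r b < r c \<or> r c < r b \<and> r b < r a"

lemma distinct_set_3_cases:
  assumes "distinct l" "set l = {a, b, c}" "a \<noteq> b" "b \<noteq> c" "a \<noteq> c"
  shows "l \<in> {[a,b,c], [a,c,b], [b,a,c], [b,c,a], [c,a,b], [c,b,a]}"
proof -
  have "length l = 3" using assms distinct_card[OF assms(1)] by simp
  then obtain x y z where l: "l = [x, y, z]"
    by (auto simp: numeral_3_eq_3 length_Suc_conv)
  have "x \<in> {a, b, c}" "y \<in> {a, b, c}" "z \<in> {a, b, c}"
    unfolding assms(2)[symmetric] l by simp_all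
  moreover have "x \<noteq> y" "y \<noteq> z" "x \<noteq> z"
    using assms(1) l by simp_all
  ultimately show ?thesis unfolding l by auto
qed

text \<open>The signs alternate exactly when the only \<open>-1\<close>, at \<open>b\<close>, stands
  in the middle.\<close>

lemma alternating_list_triple_iff:
  assumes "distinct ws" "{x \<in> set ws. f x \<noteq> 0} = {a, b, c}" "a \<noteq> b" "b \<noteq> c" "a \<noteq> c"
    and f: "f a = 1" "f b = -1" "f c = 1"
  shows "alternating_list (map f ws) \<longleftrightarrow> filter (\<lambda>x. f x \<noteq> 0) ws \<in> {[a, b, c], [c, b, a]}"
proof -
  define l where "l = filter (\<lambda>x. f x \<noteq> 0) ws"
  have "distinct l" "set l = {a, b, c}"
    using assms(1,2) by (simp_all add: l_def)
  then have l: "l \<in> {[a,b,c], [a,c,b], [b,a,c], [b,c,a], [c,a,b], [c,b,a]}"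
    using distinct_set_3_cases assms(3-5) by metis
  have "filter (\<lambda>y. y \<noteq> 0) (map f ws) = map f l"
    by (simp add: filter_map comp_def l_def)
  then have "alternating_list (map f ws) \<longleftrightarrow>
      map f l \<noteq> [] \<and> hd (map f l) = 1 \<and> last (map f l) = 1 \<and> successively (\<lambda>x y. y = - x) (map f l)"
    by (simp only: alternating_list_def Let_def)
  also have "\<dots> \<longleftrightarrow> l \<in> {[a, b, c], [c, b, a]}"
    using l by (elim insertE emptyE) (simp_all add: f assms(3-5)[symmetric])
  finally show ?thesis unfolding l_def .
qed

text \<open>Weak sortedness suffices: the strict inequalities in \<open>between\<close> already
  exclude the other four orders of the three vertices.\<close>

lemma between_imp_alternating:
  assumes "distinct ws" "{x \<in> set ws. f x \<noteq> 0} = {a, b, c}" "a \<noteq> b" "b \<noteq> c" "a \<noteq> c"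
    and "f a = 1" "f b = -1" "f c = 1" "sorted (map r ws)" "between r a b c"
  shows "alternating_list (map f ws)"
proof -
  let ?l = "filter (\<lambda>x. f x \<noteq> 0) ws"
  have "distinct ?l" "set ?l = {a, b, c}"
    using assms(1,2) by simp_all
  then have "?l \<in> {[a,b,c], [a,c,b], [b,a,c], [b,c,a], [c,a,b], [c,b,a]}"
    using distinct_set_3_cases assms(3-5) by metis
  moreover have "sorted (map r ?l)"
    using assms(9) by (rule sorted_filter)
  ultimately have "?l \<in> {[a, b, c], [c, b, a]}"
    using assms(10) unfolding between_def by auto
  then show ?thesis
    using alternating_list_triple_iff[OF assms(1-8)] by blast
qed

lemma alternating_imp_between:
  assumes "distinct ws" "{x \<in> set ws. f x \<noteq> 0} = {a, b, c}" "a \<noteq> b" "b \<noteq> c" "a \<noteq> c"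
    and "f a = 1" "f b = -1" "f c = 1" "sorted_wrt (<) (map r ws)" "alternating_list (map f ws)"
  shows "between r a b c"
proof -
  let ?l = "filter (\<lambda>x. f x \<noteq> 0) ws"
  have "?l \<in> {[a, b, c], [c, b, a]}"
    using alternating_list_triple_iff[OF assms(1-8)] assms(10) by blast
  moreover have "sorted_wrt (<) (map r ?l)"
    using assms(9) by (simp add: sorted_wrt_map sorted_wrt_filter)
  ultimately show ?thesis
    unfolding between_def by auto
qed

lemma distinct_strict_sorted_rank:
  assumes "distinct ws"
  obtains r :: "'a \<Rightarrow> nat" where "sorted_wrt (<) (map r ws)"
proof -
  \<comment> \<open>The rank of a vertex is its position in \<open>ws\<close>.\<close>
  define r where "r = the_inv_into {..<length ws} ((!) ws)"
  have inj: "inj_on ((!) ws) {..<length ws}"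
    using assms by (simp add: inj_on_nth)
  have "map r ws = [0..<length ws]"
    by (rule nth_equalityI) (use the_inv_into_f_f[OF inj] in \<open>auto simp: r_def\<close>)
  then show thesis using that[of r] by simp
qed

section \<open>Matrix entries\<close>

definition entry :: "'a pair_pre_digraph \<Rightarrow> ('a \<times> 'a \<Rightarrow> colour) \<Rightarrow> 'a \<Rightarrow> 'a \<Rightarrow> int" where
  "entry G \<kappa> x y =
     (if (x, y) \<in> parcs G then (case \<kappa> (x, y) of Blue \<Rightarrow> 1 | Red \<Rightarrow> -1) else 0)"

lemma entry_eq_0_iff: "entry G \<kappa> x y = 0 \<longleftrightarrow> (x, y) \<notin> parcs G"
  by (simp add: entry_def split: colour.split)

text \<open>Shape and range of entries are automatic for a colour matrix; what remains is stated by
  vertices instead of indices.\<close>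

lemma alternating_sign_matrix_colour_mat_iff:
  "alternating_sign_matrix (colour_mat G \<kappa> ws) \<longleftrightarrow>
     (\<forall>x \<in> set ws. alternating_list (map (entry G \<kappa> x) ws)) \<and>
     (\<forall>y \<in> set ws. alternating_list (map (\<lambda>x. entry G \<kappa> x y) ws))"
proof -
  let ?A = "colour_mat G \<kappa> ws"
  have dims: "dim_row ?A = length ws" "dim_col ?A = length ws"
    by (simp_all add: colour_mat_def)
  have ix: "?A $$ (i, j) = entry G \<kappa> (ws ! i) (ws ! j)" if "i < length ws" "j < length ws" for i j
    using that by (simp add: colour_mat_def entry_def)
  have "elements_mat ?A \<subseteq> {0, 1, -1}"
    by (auto simp: elements_mat_def dims ix entry_def split: colour.splits if_splits)
  moreover have "square_mat ?A" by (simp add: dims)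
  moreover have "list_of_vec (row ?A i) = map (entry G \<kappa> (ws ! i)) ws" if "i < length ws" for i
    by (rule nth_equalityI) (use that in \<open>auto simp: dims ix list_of_vec_index\<close>)
  moreover have "list_of_vec (col ?A j) = map (\<lambda>x. entry G \<kappa> x (ws ! j)) ws" if "j < length ws" for j
    by (rule nth_equalityI) (use that in \<open>auto simp: dims ix list_of_vec_index\<close>)
  ultimately show ?thesis
    by (simp add: alternating_sign_matrix_def dims alternating_vec_def
        flip: alternating_list_def add: all_set_conv_all_nth)
qed

section \<open>Orderings of a PT-graph\<close>

text \<open>Here \<open>t1\<close> and \<open>t2\<close> are the cycle predecessors of
  \<open>v1\<close> and \<open>v2\<close>. An ordering yields its positions as ranks; a rank yields
  an ordering by sorting.\<close>

lemma (in PT_graph_2c) ordering_iff_rank: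
  assumes s: "bij_betw s (pverts C1) (pverts C1)" "bij_betw s (pverts C2) (pverts C2)"
    and arcs: "parcs C1 = (\<lambda>x. (x, s x)) ` pverts C1" "parcs C2 = (\<lambda>x. (x, s x)) ` pverts C2"
    and t: "t1 \<in> pverts C2" "t2 \<in> pverts C2" "s t1 = v1" "s t2 = v2"
  shows "(\<exists>ws. vertex_ordering G ws \<and> alternating_sign_matrix (colour_mat G \<kappa> ws)) \<longleftrightarrow>
    (\<exists>r. between r (s u1) v1 v2 \<and> between r (s u2) v2 v1 \<and>
         between r t1 u1 u2 \<and> between r t2 u2 u1)"
    (is "?L \<longleftrightarrow> ?R")
proof -
  let ?V = "pverts G" and ?T = "{(u1, v1), (u2, v2), (u1, v2), (u2, v1)}"
  have s_in: "s x \<in> pverts C1" if "x \<in> pverts C1" for x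
    using bij_betwE[OF s(1)] that by blast
  have bij: "bij_betw s ?V ?V"
    unfolding verts_eq by (rule bij_betw_combine[OF s disjoint])
  have arc_iff: "(x, y) \<in> parcs G \<longleftrightarrow> x \<in> ?V \<and> y = s x \<or> (x, y) \<in> ?T" for x y
    unfolding arcs_eq verts_eq arcs by auto
  have in_V: "u1 \<in> ?V" "u2 \<in> ?V" "v1 \<in> ?V" "v2 \<in> ?V" "s u1 \<in> ?V" "s u2 \<in> ?V" "t1 \<in> ?V" "t2 \<in> ?V"
    using u_in v_in t s_in by (auto simp: verts_eq)
  \<comment> \<open>Each pair lies in different cycles; this keeps the three non-zero entries of a
    special row or column apart.\<close>
  have ne: "s u1 \<noteq> v1" "s u1 \<noteq> v2" "s u2 \<noteq> v1" "s u2 \<noteq> v2"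
      "t1 \<noteq> u1" "t1 \<noteq> u2" "t2 \<noteq> u1" "t2 \<noteq> u2"
    using s_in[OF u_in(1)] s_in[OF u_in(2)] t(1,2) u_in v_in disjoint by (auto simp: disjoint_iff)
  have blue: "entry G \<kappa> x (s x) = 1" if "x \<in> ?V" for x
  proof -
    have "(x, s x) \<in> parcs C1 \<union> parcs C2"
      using that by (auto simp: verts_eq arcs)
    then show ?thesis using P_blue[of "(x, s x)"] by (auto simp: entry_def arcs_eq)
  qed
  have T: "entry G \<kappa> u1 v1 = -1" "entry G \<kappa> u2 v2 = -1" "entry G \<kappa> u1 v2 = 1" "entry G \<kappa> u2 v1 = 1"
    by (simp_all add: entry_def arcs_eq T_red T_blue)
  have row: "{y \<in> ?V. entry G \<kappa> x y \<noteq> 0} = {s x}" if "x \<in> ?V" "x \<notin> {u1, u2}" for x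
    using that bij by (auto simp: entry_eq_0_iff arc_iff bij_betw_def)
  have row_u1: "{y \<in> ?V. entry G \<kappa> u1 y \<noteq> 0} = {s u1, v1, v2}"
    and row_u2: "{y \<in> ?V. entry G \<kappa> u2 y \<noteq> 0} = {s u2, v2, v1}"
    using in_V u_in(3) by (auto simp: entry_eq_0_iff arc_iff)
  have col: "{x \<in> ?V. entry G \<kappa> x (s z) \<noteq> 0} = {z}" if "z \<in> ?V" "s z \<notin> {v1, v2}" for z
    using that bij by (auto simp: entry_eq_0_iff arc_iff bij_betw_def dest: inj_onD)
  have col_v1: "{x \<in> ?V. entry G \<kappa> x v1 \<noteq> 0} = {t1, u1, u2}"
    and col_v2: "{x \<in> ?V. entry G \<kappa> x v2 \<noteq> 0} = {t2, u2, u1}"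
    using in_V v_in(3) t(3,4) bij by (auto simp: entry_eq_0_iff arc_iff bij_betw_def dest: inj_onD)
  have blue_t: "entry G \<kappa> t1 v1 = 1" "entry G \<kappa> t2 v2 = 1"
    using blue[of t1] blue[of t2] t in_V by simp_all
  show ?thesis
  proof
    assume ?L
    then obtain ws where ws: "distinct ws" "set ws = ?V"
        and asm: "\<And>x. x \<in> ?V \<Longrightarrow> alternating_list (map (entry G \<kappa> x) ws)"
          "\<And>y. y \<in> ?V \<Longrightarrow> alternating_list (map (\<lambda>x. entry G \<kappa> x y) ws)"
      by (auto simp: vertex_ordering_def alternating_sign_matrix_colour_mat_iff)
    obtain r :: "'a \<Rightarrow> nat" where r: "sorted_wrt (<) (map r ws)"
      using distinct_strict_sorted_rank[OF ws(1)] .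
    have "between r (s u1) v1 v2"
      by (rule alternating_imp_between[where f = "entry G \<kappa> u1", OF ws(1) _ _ _ _ _ _ _ r])
        (use row_u1 ne v_in(3) blue in_V T asm ws(2) in auto)
    moreover have "between r (s u2) v2 v1"
      by (rule alternating_imp_between[where f = "entry G \<kappa> u2", OF ws(1) _ _ _ _ _ _ _ r])
        (use row_u2 ne v_in(3) blue in_V T asm ws(2) in auto)
    moreover have "between r t1 u1 u2"
      by (rule alternating_imp_between[where f = "\<lambda>x. entry G \<kappa> x v1", OF ws(1) _ _ _ _ _ _ _ r])
        (use col_v1 ne u_in(3) blue_t in_V T asm ws(2) in auto)
    moreover have "between r t2 u2 u1"
      by (rule alternating_imp_between[where f = "\<lambda>x. entry G \<kappa> x v2", OF ws(1) _ _ _ _ _ _ _ r])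
        (use col_v2 ne u_in(3) blue_t in_V T asm ws(2) in auto)
    ultimately show ?R by blast
  next
    assume ?R
    then obtain r where r: "between r (s u1) v1 v2" "between r (s u2) v2 v1"
        "between r t1 u1 u2" "between r t2 u2 u1"
      by blast
    obtain ws0 where ws0: "set ws0 = ?V" "distinct ws0"
      using finite_distinct_list[OF pair_finite_verts] by blast
    \<comment> \<open>Vertices of equal rank keep their order from \<open>ws0\<close>; this is
      harmless, as the ranks compared in the special rows and columns differ.\<close>
    define ws where "ws = sort_key r ws0"
    have ws: "set ws = ?V" "distinct ws" "sorted (map r ws)"
      using ws0 by (simp_all add: ws_def)
    have "alternating_list (map (entry G \<kappa> x) ws)" if x: "x \<in> ?V" for x
    proof -
      consider "x = u1" | "x = u2" | "x \<notin> {u1, u2}" by blast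
      then show ?thesis
      proof cases
        case 1
        show ?thesis unfolding 1
          by (rule between_imp_alternating[OF ws(2) _ _ _ _ _ _ _ ws(3) r(1)])
            (use row_u1 ne v_in(3) blue in_V T ws(1) in auto)
      next
        case 2
        show ?thesis unfolding 2
          by (rule between_imp_alternating[OF ws(2) _ _ _ _ _ _ _ ws(3) r(2)])
            (use row_u2 ne v_in(3) blue in_V T ws(1) in auto)
      next
        case 3
        show ?thesis
          by (rule alternating_list_single[OF ws(2)]) (use row[OF x 3] blue[OF x] ws(1) in auto)
      qed
    qed
    moreover have "alternating_list (map (\<lambda>x. entry G \<kappa> x y) ws)" if y: "y \<in> ?V" for y
    proof -
      consider "y = v1" | "y = v2" | "y \<notin> {v1, v2}" by blast
      then show ?thesis
      proof cases
        case 1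
        show ?thesis unfolding 1
          by (rule between_imp_alternating[OF ws(2) _ _ _ _ _ _ _ ws(3) r(3)])
            (use col_v1 ne u_in(3) blue_t in_V T ws(1) in auto)
      next
        case 2
        show ?thesis unfolding 2
          by (rule between_imp_alternating[OF ws(2) _ _ _ _ _ _ _ ws(3) r(4)])
            (use col_v2 ne u_in(3) blue_t in_V T ws(1) in auto)
      next
        case 3
        obtain z where z: "z \<in> ?V" "y = s z"
          using y bij by (auto simp: bij_betw_def)
        show ?thesis
          by (rule alternating_list_single[OF ws(2)])
            (use col[of z] 3 blue[of z] z ws(1) in auto)
      qed
    qed
    ultimately have "alternating_sign_matrix (colour_mat G \<kappa> ws)"
      by (simp add: alternating_sign_matrix_colour_mat_iff ws(1))
    then show ?L using ws by (auto simp: vertex_ordering_def)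
  qed
qed

text \<open>The hypotheses leave only the coincidences \<open>s1 = u2\<close>,
  \<open>s2 = u1\<close>, \<open>t1 = v2\<close> and \<open>t2 = v1\<close> possible among the eight
  vertices.\<close>

lemma between_rank_iff:
  assumes "u1 \<noteq> u2" "v1 \<noteq> v2" "u1 \<noteq> v1" "u1 \<noteq> v2" "u2 \<noteq> v1" "u2 \<noteq> v2"
    and "s1 \<noteq> s2" "s1 \<noteq> u1" "s2 \<noteq> u2" "t1 \<noteq> t2" "t1 \<noteq> v1" "t2 \<noteq> v2"
    and "{s1, s2} \<inter> {v1, v2, t1, t2} = {}" "{t1, t2} \<inter> {u1, u2} = {}"
  shows "(\<exists>r. between r s1 v1 v2 \<and> between r s2 v2 v1 \<and> between r t1 u1 u2 \<and> between r t2 u2 u1) \<longleftrightarrow>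
    \<not> (s1 = u2 \<and> s2 = u1 \<and> (t2 = v1 \<or> t1 = v2) \<or> t2 = v1 \<and> t1 = v2 \<and> (s1 = u2 \<or> s2 = u1))"
    (is "?L \<longleftrightarrow> \<not> ?R")
proof
  assume ?L
  \<comment> \<open>If \<open>s1 = u2\<close> and \<open>s2 = u1\<close>, the first two conditions
    force the order \<open>u2, v1, v2, u1\<close> up to reversal. Then \<open>u1\<close> and
    \<open>u2\<close> are extreme, against the last two conditions once \<open>t1 = v2\<close> or
    \<open>t2 = v1\<close>. The other case is symmetric, with order
    \<open>v2, u1, u2, v1\<close>.\<close>
  then show "\<not> ?R" unfolding between_def by auto
next
  assume R: "\<not> ?R"
  \<comment> \<open>The values at \<open>u1, u2, v1, v2\<close> override those at \<open>s1, s2, t1, t2\<close> in case of coincidence.\<close>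
  let ?r = "\<lambda>a b c d x y z w. (\<lambda>_. 0 :: nat)(s1 := x, s2 := y, t1 := z, t2 := w, u1 := a, u2 := b, v1 := c, v2 := d)"
  consider "s2 \<noteq> u1" "t1 \<noteq> v2" | "s1 \<noteq> u2" "t2 \<noteq> v1"
    | "t2 \<noteq> v1" "t1 \<noteq> v2" | "s1 \<noteq> u2" "s2 \<noteq> u1"
    | "s2 \<noteq> u1" "t2 \<noteq> v1" | "s1 \<noteq> u2" "t1 \<noteq> v2"
    using R by blast \<comment> \<open>\<open>R\<close> says that at least two of the four possible coincidences fail.\<close>
  then show ?L
  proof cases
    case 1
    \<comment> \<open>In all six cases ranks 1 to 4 go to \<open>u1, u2, v1, v2\<close> and the
      extremes 0 and 5 to the neighbours. A coincidence still allowed replaces an extreme by a rank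
      on the same side of the two it is compared with.\<close>
    show ?thesis
      by (rule exI[of _ "?r 1 2 3 4 0 5 0 5"]) (use assms 1 in \<open>auto simp: between_def\<close>)
  next
    case 2
    show ?thesis
      by (rule exI[of _ "?r 3 4 1 2 0 5 0 5"]) (use assms 2 in \<open>auto simp: between_def\<close>)
  next
    case 3
    show ?thesis
      by (rule exI[of _ "?r 4 1 2 3 0 5 5 0"]) (use assms 3 in \<open>auto simp: between_def\<close>)
  next
    case 4
    show ?thesis
      by (rule exI[of _ "?r 3 2 1 4 0 5 5 0"]) (use assms 4 in \<open>auto simp: between_def\<close>)
  next
    case 5
    show ?thesis
      by (rule exI[of _ "?r 2 1 3 4 0 5 5 0"]) (use assms 5 in \<open>auto simp: between_def\<close>)
  next
    case 6
    show ?thesis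
      by (rule exI[of _ "?r 4 3 1 2 0 5 5 0"]) (use assms 6 in \<open>auto simp: between_def\<close>)
  qed
qed

theorem theorem5p2:
  fixes G C1 C2 :: "'a pair_pre_digraph"
    and \<kappa> :: "'a \<times> 'a \<Rightarrow> colour"
    and u1 u2 v1 v2 :: 'a
  assumes "PT_graph_2c G \<kappa> C1 C2 u1 u2 v1 v2"
  shows "(\<exists>ws. vertex_ordering G ws \<and> alternating_sign_matrix (colour_mat G \<kappa> ws)) \<longleftrightarrow>
    \<not> ((card (parcs C1) = 2 \<and> consecutive C2 v1 v2) \<or>
       (card (parcs C2) = 2 \<and> consecutive C1 u1 u2))"
proof -
  interpret PT_graph_2c G \<kappa> C1 C2 u1 u2 v1 v2 by (rule assms)
  obtain f where f: "finite (pverts C1)" "bij_betw f (pverts C1) (pverts C1)"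
    "parcs C1 = (\<lambda>x. (x, f x)) ` pverts C1"
    "\<And>S. S \<subseteq> pverts C1 \<Longrightarrow> S \<noteq> {} \<Longrightarrow> f ` S \<subseteq> S \<Longrightarrow> S = pverts C1"
    using directed_cycle_successor[OF cycle1] by blast
  obtain g where g: "finite (pverts C2)" "bij_betw g (pverts C2) (pverts C2)"
    "parcs C2 = (\<lambda>x. (x, g x)) ` pverts C2"
    "\<And>S. S \<subseteq> pverts C2 \<Longrightarrow> S \<noteq> {} \<Longrightarrow> g ` S \<subseteq> S \<Longrightarrow> S = pverts C2"
    using directed_cycle_successor[OF cycle2] by blast
  \<comment> \<open>The two successor maps are glued into one, as \<open>ordering_iff_rank\<close>
    expects.\<close>
  define s where "s = (\<lambda>x. if x \<in> pverts C1 then f x else g x)"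
  have s1: "s x = f x" if "x \<in> pverts C1" for x using that by (simp add: s_def)
  have s2: "s x = g x" if "x \<in> pverts C2" for x using that disjoint by (auto simp: s_def)
  have bij: "bij_betw s (pverts C1) (pverts C1)" "bij_betw s (pverts C2) (pverts C2)"
    using f(2) g(2) bij_betw_cong[of "pverts C1" s f] bij_betw_cong[of "pverts C2" s g] s1 s2 by auto
  have arcs: "parcs C1 = (\<lambda>x. (x, s x)) ` pverts C1" "parcs C2 = (\<lambda>x. (x, s x)) ` pverts C2"
    using f(3) g(3) s1 s2 by auto
  have min1: "S = pverts C1" if S: "S \<subseteq> pverts C1" "S \<noteq> {}" "s ` S \<subseteq> S" for S
  proof (rule f(4)[OF S(1,2)])
    show "f ` S \<subseteq> S" using S(1,3) s1 by (metis image_cong subsetD)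
  qed
  have min2: "S = pverts C2" if S: "S \<subseteq> pverts C2" "S \<noteq> {}" "s ` S \<subseteq> S" for S
  proof (rule g(4)[OF S(1,2)])
    show "g ` S \<subseteq> S" using S(1,3) s2 by (metis image_cong subsetD)
  qed
  obtain t1 t2 where t: "t1 \<in> pverts C2" "t2 \<in> pverts C2" "s t1 = v1" "s t2 = v2"
    using bij(2) v_in by (metis bij_betw_def imageE)
  have eq1: "s x = s y \<longleftrightarrow> x = y" if "x \<in> pverts C1" "y \<in> pverts C1" for x y
    using bij(1) that by (auto simp: bij_betw_def dest: inj_onD)
  have eq2: "s x = s y \<longleftrightarrow> x = y" if "x \<in> pverts C2" "y \<in> pverts C2" for x y
    using bij(2) that by (auto simp: bij_betw_def dest: inj_onD)
  have s_in: "s u1 \<in> pverts C1" "s u2 \<in> pverts C1"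
    using bij(1) u_in by (auto simp: bij_betw_def)
  have no_fix: "s u1 \<noteq> u1" "s u2 \<noteq> u2" "s v1 \<noteq> v1" "s v2 \<noteq> v2"
    using no_fixed_point[OF u_in _ min1] no_fixed_point[OF v_in _ min2] u_in v_in by blast+
  \<comment> \<open>Injectivity of \<open>s\<close> turns coincidences of predecessors into arcs
    between \<open>v1\<close> and \<open>v2\<close>.\<close>
  have t_iff: "t2 = v1 \<longleftrightarrow> s v1 = v2" "t1 = v2 \<longleftrightarrow> s v2 = v1"
    using eq2[of t2 v1] eq2[of t1 v2] t v_in by auto
  have t_ne: "t1 \<noteq> v1" "t2 \<noteq> v2" "t1 \<noteq> t2"
    using no_fix t v_in(3) by auto
  have card1: "card (parcs C1) = 2 \<longleftrightarrow> s u1 = u2 \<and> s u2 = u1"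
    unfolding arcs(1) by (rule card_parcs_eq_2_iff[OF f(1) bij(1) u_in min1])
  have card2: "card (parcs C2) = 2 \<longleftrightarrow> s v1 = v2 \<and> s v2 = v1"
    unfolding arcs(2) by (rule card_parcs_eq_2_iff[OF g(1) bij(2) v_in min2])
  have cons: "consecutive C1 u1 u2 \<longleftrightarrow> s u1 = u2 \<or> s u2 = u1"
      "consecutive C2 v1 v2 \<longleftrightarrow> s v1 = v2 \<or> s v2 = v1"
    using u_in v_in by (auto simp: consecutive_def arcs)
  have "(\<exists>ws. vertex_ordering G ws \<and> alternating_sign_matrix (colour_mat G \<kappa> ws)) \<longleftrightarrow>
      (\<exists>r. between r (s u1) v1 v2 \<and> between r (s u2) v2 v1 \<and> between r t1 u1 u2 \<and> between r t2 u2 u1)"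
    by (rule ordering_iff_rank[OF bij arcs t])
  also have "\<dots> \<longleftrightarrow>
    \<not> (s u1 = u2 \<and> s u2 = u1 \<and> (t2 = v1 \<or> t1 = v2) \<or> t2 = v1 \<and> t1 = v2 \<and> (s u1 = u2 \<or> s u2 = u1))"
  proof (rule between_rank_iff)
    show "s u1 \<noteq> s u2" using eq1 u_in by auto
    show "{s u1, s u2} \<inter> {v1, v2, t1, t2} = {}" "{t1, t2} \<inter> {u1, u2} = {}"
      "u1 \<noteq> v1" "u1 \<noteq> v2" "u2 \<noteq> v1" "u2 \<noteq> v2"
      using disjoint s_in t(1,2) u_in v_in by auto
  qed (use u_in v_in no_fix t_ne in auto)
  \<comment> \<open>Both coincidences in one cycle mean length 2; at least one in the other means
    consecutive vertices.\<close>
  finally show ?thesis unfolding card1 card2 cons t_iff by blast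
qed

end
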